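(* Let $n\ge 1$ be an integer, let $\alpha>-1$ be real, let $a\neq 0$ be real, and let $0<t\le 2$. Put $$R_n^{\alpha,t}=L_n^{\alpha}+a\,L_n^{\alpha+t}.$$ Then the zeros of $R_n^{\alpha,t}$ interlace with (i) the zeros of $L_n^{\alpha}$, and (ii) the zeros of $L_n^{\alpha+t}$.
   Context: For real $\beta>-1$ and integer $n\ge 0$, $L_n^{\beta}$ denotes the Laguerre polynomial $$L_n^{\beta}(x)=\sum_{k=0}^n(-1)^k\binom{n+\beta}{n-k}\frac{x^k}{k!},$$ where $\binom{n+\beta}{n-k}=\frac{\Gamma(n+\beta+1)}{\Gamma(n-k+1)\,\Gamma(\beta+k+1)}$. The polynomials $L_n^\beta$, $n\ge 0$, are orthogonal on $(0,\infty)$ with respect to the weight $e^{-x}x^{\beta}$. Interlacing: the zeros of two nonzero real polynomials $p$ and $q$, whose degrees differ by at most $1$, are said to interlace if all zeros of $p$ and of $q$ are real and simple, $p$ and $q$ have no common zero, and strictly between any two consecutive zeros of either polynomial there is exactly one zero of the other. (The zeros are not required to lie in $(0,\infty)$. If $a=-1$, then $R_n^{\alpha,t}$ has degree $n-1$.) *)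

theory Defs
  imports
    "HOL-Analysis.Gamma_Function"
    "HOL-Computational_Algebra.Polynomial"
begin

definition laguerre :: "nat \<Rightarrow> real \<Rightarrow> real poly" where
  "laguerre n \<beta> =
     (\<Sum>k=0..n. monom ((-1) ^ k
        * (Gamma (real n + \<beta> + 1) / (Gamma (real n - real k + 1) * Gamma (\<beta> + real k + 1)))
        / fact k) k)"

definition laguerre_comb :: "nat \<Rightarrow> real \<Rightarrow> real \<Rightarrow> real \<Rightarrow> real poly" where
  "laguerre_comb n \<alpha> t a = laguerre n \<alpha> + smult a (laguerre n (\<alpha> + t))"

(* A zero of a real polynomial is a complex zero; order z P is its multiplicity. *)
definition zeros_real_simple :: "real poly \<Rightarrow> bool" where
  "zeros_real_simple p \<longleftrightarrow>
     (let P = map_poly complex_of_real p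
      in \<forall>z. poly P z = 0 \<longrightarrow> z \<in> \<real> \<and> order z P = 1)"

definition consecutive_zeros :: "real poly \<Rightarrow> real \<Rightarrow> real \<Rightarrow> bool" where
  "consecutive_zeros p x y \<longleftrightarrow>
     x < y \<and> poly p x = 0 \<and> poly p y = 0 \<and> (\<forall>z. x < z \<and> z < y \<longrightarrow> poly p z \<noteq> 0)"

(* Because all zeros are required to be real, the absence of common zeros and the
   conditions on gaps need only mention real zeros. A polynomial with fewer than two
   zeros has no consecutive zeros, so its own gap condition is vacuous. *)
definition zeros_interlace :: "real poly \<Rightarrow> real poly \<Rightarrow> bool" where
  "zeros_interlace p q \<longleftrightarrow>
     p \<noteq> 0 \<and> q \<noteq> 0 \<and>
     degree p \<le> degree q + 1 \<and> degree q \<le> degree p + 1 \<and>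
     zeros_real_simple p \<and> zeros_real_simple q \<and>
     (\<forall>x. \<not> (poly p x = 0 \<and> poly q x = 0)) \<and>
     (\<forall>x y. consecutive_zeros p x y \<longrightarrow> (\<exists>!z. x < z \<and> z < y \<and> poly q z = 0)) \<and>
     (\<forall>x y. consecutive_zeros q x y \<longrightarrow> (\<exists>!z. x < z \<and> z < y \<and> poly p z = 0))"

end

theory Submission
  imports Defs
begin

text \<open>For \<open>0 < t \<le> 2\<close> the \<open>k\<close>-th zero \<open>y\<^sub>k\<close> of \<open>L\<^sub>n\<^sup>\<alpha>\<^sup>+\<^sup>t\<close> lies strictly between consecutive zeros
  \<open>x\<^sub>k\<close> and \<open>x\<^sub>k\<^sub>+\<^sub>1\<close> of \<open>L\<^sub>n\<^sup>\<alpha>\<close>: the zeros increase strictly with the parameter, by comparison of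
  Stieltjes' equilibrium equations, and at the zeros of \<open>L\<^sub>n\<^sup>\<alpha>\<close> the relation
  \<open>x L\<^sub>n\<^sup>\<alpha>\<^sup>+\<^sup>2 = (x - n) L\<^sub>n\<^sup>\<alpha> - (x + \<alpha> + 1) (L\<^sub>n\<^sup>\<alpha>)'\<close> forces the sign changes that keep the \<open>k\<close>-th zero
  of \<open>L\<^sub>n\<^sup>\<alpha>\<^sup>+\<^sup>2\<close> below \<open>x\<^sub>k\<^sub>+\<^sub>1\<close>. Hence the Wronskian of \<open>L\<^sub>n\<^sup>\<alpha>\<close> and \<open>L\<^sub>n\<^sup>\<alpha>\<^sup>+\<^sup>t\<close> has no real zero. Up to a nonzero
  factor it is also the Wronskian of \<open>R\<^sub>n\<close> with either polynomial, and a Wronskian without real zeros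
  means interlacing once all zeros are known to be real.\<close>

section \<open>Interlacing and Wronskians\<close>

lemma map_poly_of_real_mult:
  "map_poly complex_of_real (p * q) = map_poly complex_of_real p * map_poly complex_of_real q"
  by (rule poly_eqI) (simp add: coeff_map_poly coeff_mult)

lemma poly_map_poly_of_real:
  "poly (map_poly complex_of_real p) (complex_of_real x) = complex_of_real (poly p x)"
  by (induction p) (simp_all add: map_poly_pCons)

text \<open>Dividing out the known real zeros leaves a nonzero real polynomial of degree at most 1,
  whose zero, if any, is real. So one zero may remain unlocated.\<close>

lemma complex_zeros_real:
  fixes p :: "real poly"
  assumes "p \<noteq> 0" "finite Z" "\<And>x. x \<in> Z \<Longrightarrow> poly p x = 0" "degree p \<le> card Z + 1"
    and "poly (map_poly complex_of_real p) z = 0"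
  shows "z \<in> \<real>"
  using assms(2,1,3,4,5)
proof (induction Z arbitrary: p rule: finite_induct)
  case empty
  define b c where "b = coeff p 0" and "c = coeff p 1"
  have p: "p = [:b, c:]"
    using empty.prems(3) degree_eq_zeroE[of p]
    by (intro poly_eqI) (auto simp: b_def c_def coeff_pCons coeff_eq_0 split: nat.splits)
  have eq: "of_real b + of_real c * z = 0"
    using empty.prems(4) by (simp add: p map_poly_pCons mult.commute)
  have "c \<noteq> 0" using eq empty.prems(1) p by auto
  then have "z = of_real (- b / c)" using eq
    by (simp add: field_simps eq_neg_iff_add_eq_0 add.commute)
  then show ?case by (metis Reals_of_real)
next
  case (insert a Z)
  obtain q where q: "p = [:- a, 1:] * q"
    using insert.prems(2)[of a] poly_eq_0_iff_dvd[of p a] by (auto elim: dvdE)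
  have "q \<noteq> 0" using q insert.prems(1) by auto
  have deg: "degree p = Suc (degree q)"
    using \<open>q \<noteq> 0\<close> by (simp add: q degree_mult_eq del: mult_pCons_left)
  have "(z - of_real a) * poly (map_poly complex_of_real q) z = 0"
    using insert.prems(4) by (simp add: q map_poly_of_real_mult map_poly_pCons del: mult_pCons_left)
  then consider "z = of_real a" | "poly (map_poly complex_of_real q) z = 0" by auto
  then show ?case
  proof cases
    case 2
    have "poly q x = 0" if "x \<in> Z" for x
      using insert.prems(2)[of x] that insert.hyps(2) by (auto simp: q)
    then show ?thesis
      using insert.IH[of q] \<open>q \<noteq> 0\<close> 2 insert.prems(3) insert.hyps deg by simp
  qed simp
qed

definition wronskian :: "real poly \<Rightarrow> real poly \<Rightarrow> real poly" where
  "wronskian p q = p * pderiv q - pderiv p * q"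

lemma zeros_real_simpleI:
  fixes p :: "real poly"
  assumes "p \<noteq> 0" "finite Z" "\<And>x. x \<in> Z \<Longrightarrow> poly p x = 0" "degree p \<le> card Z + 1"
    and simple: "\<And>x. poly p x = 0 \<Longrightarrow> poly (pderiv p) x \<noteq> 0"
  shows "zeros_real_simple p"
proof -
  let ?P = "map_poly complex_of_real p"
  have "z \<in> \<real> \<and> order z ?P = 1" if z: "poly ?P z = 0" for z
  proof -
    obtain x where x: "z = of_real x"
      using complex_zeros_real[OF assms(1-4) z] by (auto elim: Reals_cases)
    have "?P \<noteq> 0" using \<open>p \<noteq> 0\<close> by (simp add: map_poly_eq_0_iff)
    have "pderiv ?P = map_poly complex_of_real (pderiv p)"
      by (rule poly_eqI) (simp add: coeff_map_poly coeff_pderiv)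
    then have "poly (pderiv ?P) z \<noteq> 0"
      using z simple[of x] by (simp add: x poly_map_poly_of_real)
    then have "order z (pderiv ?P) = 0" by (meson order_root)
    then show ?thesis using order_pderiv[OF \<open>?P \<noteq> 0\<close> z] x by simp
  qed
  then show ?thesis by (simp add: zeros_real_simple_def Let_def)
qed

lemma consecutive_zeros_exist:
  fixes p :: "real poly"
  assumes "p \<noteq> 0" "u < v" "poly p u = 0" "poly p v = 0"
  obtains w where "w \<le> v" "consecutive_zeros p u w"
proof -
  let ?S = "{w. poly p w = 0 \<and> u < w}"
  have "finite ?S" by (rule finite_subset[OF _ poly_roots_finite[OF \<open>p \<noteq> 0\<close>]]) auto
  moreover have "v \<in> ?S" using assms by simp
  ultimately have "Min ?S \<in> ?S" "Min ?S \<le> v" "w \<notin> ?S" if "w < Min ?S" for w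
    using Min_in[of ?S] Min_le[of ?S] that by (blast, blast, meson leD)
  moreover have "\<exists>w. w < Min ?S" by (rule lt_ex)
  ultimately show ?thesis
    using that[of "Min ?S"] assms(3) unfolding consecutive_zeros_def by blast
qed

lemma same_sign_between_zeros:
  fixes p :: "real poly"
  assumes "\<And>z. x \<le> z \<Longrightarrow> z \<le> y \<Longrightarrow> poly p z \<noteq> 0" "x \<le> y"
  shows "poly p x * poly p y > 0"
proof (rule ccontr)
  assume "\<not> ?thesis"
  moreover have "poly p x \<noteq> 0" "poly p y \<noteq> 0" using assms by auto
  ultimately have "poly p x * poly p y < 0" by (simp add: less_le)
  moreover from this have "x < y" using assms(2) by (cases "x = y") (auto simp: mult_less_0_iff)
  ultimately obtain z where "x < z" "z < y" "poly p z = 0" using poly_IVT[of x y p] by auto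
  with assms(1)[of z] show False by simp
qed

text \<open>Factor \<open>p\<close> as \<open>(X - x) (X - y) r\<close>. The cofactor
  \<open>r\<close> keeps one sign on the closed interval, and the derivatives at the ends are
  \<open>(x - y) r(x)\<close> and \<open>(y - x) r(y)\<close>.\<close>

lemma pderiv_consecutive_zeros:
  assumes c: "consecutive_zeros p x y"
    and nz: "poly (pderiv p) x \<noteq> 0" "poly (pderiv p) y \<noteq> 0"
  shows "poly (pderiv p) x * poly (pderiv p) y < 0"
proof -
  have xy: "x < y" "poly p x = 0" "poly p y = 0" using c by (auto simp: consecutive_zeros_def)
  obtain q where q: "p = [:- x, 1:] * q"
    using xy poly_eq_0_iff_dvd[of p x] by (auto elim: dvdE)
  have "poly q y = 0" using xy by (auto simp: q)
  then obtain r where r: "q = [:- y, 1:] * r"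
    using poly_eq_0_iff_dvd[of q y] by (auto elim: dvdE)
  have dx: "poly (pderiv p) x = (x - y) * poly r x" and dy: "poly (pderiv p) y = (y - x) * poly r y"
    by (simp_all add: q r pderiv_mult pderiv_pCons del: mult_pCons_left mult_pCons_right)
  have "poly r z \<noteq> 0" if "x \<le> z" "z \<le> y" for z
  proof (cases "z = x \<or> z = y")
    case True
    then show ?thesis using nz dx dy by auto
  next
    case False
    then have "poly p z \<noteq> 0" using c that by (auto simp: consecutive_zeros_def)
    then show ?thesis by (auto simp: q r)
  qed
  then have "poly r x * poly r y > 0" using xy by (intro same_sign_between_zeros) auto
  then have "(x - y) * (y - x) * (poly r x * poly r y) < 0"
    using xy by (intro mult_neg_pos) (auto simp: mult_less_0_iff)
  then show ?thesis by (simp add: dx dy algebra_simps)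
qed

text \<open>At a zero of \<open>p\<close> the Wronskian equals \<open>- p' q\<close>. It keeps its
  sign while \<open>p'\<close> changes sign from \<open>x\<close> to \<open>y\<close>, so
  \<open>q\<close> must change sign too.\<close>

lemma wronskian_zero_between:
  assumes W: "\<And>x. poly (wronskian p q) x \<noteq> 0" and c: "consecutive_zeros p x y"
  shows "\<exists>z. x < z \<and> z < y \<and> poly q z = 0"
proof -
  have xy: "x < y" "poly p x = 0" "poly p y = 0" using c by (auto simp: consecutive_zeros_def)
  have Wx: "poly (wronskian p q) x = - (poly (pderiv p) x * poly q x)"
    and Wy: "poly (wronskian p q) y = - (poly (pderiv p) y * poly q y)"
    using xy by (simp_all add: wronskian_def)
  have nz: "poly (pderiv p) x \<noteq> 0" "poly (pderiv p) y \<noteq> 0"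
    using W[of x] W[of y] by (auto simp: Wx Wy)
  have "0 < (poly (pderiv p) x * poly (pderiv p) y) * (poly q x * poly q y)"
    using same_sign_between_zeros[of x y "wronskian p q"] W xy by (simp add: Wx Wy mult_ac)
  then have "poly q x * poly q y < 0"
    using pderiv_consecutive_zeros[OF c nz] by (metis mult_less_cancel_right_disj mult_zero_left mult.commute not_less_iff_gr_or_eq)
  then show ?thesis using poly_IVT[OF xy(1)] by auto
qed

lemma wronskian_commute: "wronskian q p = - wronskian p q"
  by (simp add: wronskian_def algebra_simps)

text \<open>Uniqueness comes from swapping roles: two zeros of \<open>q\<close> in the gap would
  enclose a zero of \<open>p\<close>.\<close>

lemma wronskian_interlace_between:
  assumes W: "\<And>x. poly (wronskian p q) x \<noteq> 0" and c: "consecutive_zeros p x y"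
  shows "\<exists>!z. x < z \<and> z < y \<and> poly q z = 0"
proof -
  have W': "poly (wronskian q p) z \<noteq> 0" for z
    using W[of z] by (simp add: wronskian_commute[of q p])
  have "q \<noteq> 0" using W[of 0] by (auto simp: wronskian_def)
  have False if "x < u" "u < v" "v < y" "poly q u = 0" "poly q v = 0" for u v
  proof -
    note uv = that
    obtain w where w: "w \<le> v" "consecutive_zeros q u w"
      using consecutive_zeros_exist[OF \<open>q \<noteq> 0\<close> \<open>u < v\<close> uv(4,5)] .
    obtain z where "u < z" "z < w" "poly p z = 0"
      using wronskian_zero_between[OF W' w(2)] by blast
    then show False using c uv w(1) by (auto simp: consecutive_zeros_def)
  qed
  then show ?thesis using wronskian_zero_between[OF W c] by (metis linorder_neqE)
qed

text \<open>A multiple or common zero would be a zero of the Wronskian. The sets \<open>X\<close>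
  and \<open>Y\<close> force all zeros to be real and may fall one short of the degrees.\<close>

lemma wronskian_imp_zeros_interlace:
  assumes W: "\<And>x. poly (wronskian p q) x \<noteq> 0"
    and "degree p \<le> degree q + 1" "degree q \<le> degree p + 1"
    and "finite X" "\<And>x. x \<in> X \<Longrightarrow> poly p x = 0" "degree p \<le> card X + 1"
    and "finite Y" "\<And>x. x \<in> Y \<Longrightarrow> poly q x = 0" "degree q \<le> card Y + 1"
  shows "zeros_interlace p q"
proof -
  have W': "poly (wronskian q p) z \<noteq> 0" for z
    using W[of z] by (simp add: wronskian_commute[of q p])
  have nz: "p \<noteq> 0" "q \<noteq> 0" using W[of 0] by (auto simp: wronskian_def)
  have simple: "poly p x \<noteq> 0 \<or> poly (pderiv p) x \<noteq> 0" "poly q x \<noteq> 0 \<or> poly (pderiv q) x \<noteq> 0"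
    "\<not> (poly p x = 0 \<and> poly q x = 0)" for x
    using W[of x] by (auto simp: wronskian_def)
  have "zeros_real_simple p"
    using zeros_real_simpleI[OF nz(1) assms(4-6)] simple by blast
  moreover have "zeros_real_simple q"
    using zeros_real_simpleI[OF nz(2) assms(7-9)] simple by blast
  ultimately show ?thesis
    unfolding zeros_interlace_def
    using nz assms(2,3) simple(3) wronskian_interlace_between[OF W] wronskian_interlace_between[OF W']
    by blast
qed

section \<open>Products of linear factors and partial fractions\<close>

definition root_prod :: "'i set \<Rightarrow> ('i \<Rightarrow> real) \<Rightarrow> real poly" where
  "root_prod A x = (\<Prod>i\<in>A. [:- x i, 1:])"

lemma poly_root_prod: "poly (root_prod A x) u = (\<Prod>i\<in>A. u - x i)"
  by (simp add: root_prod_def poly_prod)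

lemma degree_root_prod [simp]: "degree (root_prod A x) = card A"
  unfolding root_prod_def by (subst degree_prod_eq_sum_degree) auto

lemma lead_coeff_root_prod [simp]: "lead_coeff (root_prod A x) = 1"
  unfolding root_prod_def by (subst lead_coeff_prod) auto

lemma root_prod_remove:
  "finite A \<Longrightarrow> i \<in> A \<Longrightarrow> root_prod A x = [:- x i, 1:] * root_prod (A - {i}) x"
  unfolding root_prod_def by (rule prod.remove)

lemma poly_pderiv_root_prod:
  assumes "finite A" "i \<in> A"
  shows "poly (pderiv (root_prod A x)) (x i) = (\<Prod>j\<in>A - {i}. x i - x j)"
  unfolding root_prod_remove[OF assms]
  by (simp add: pderiv_mult pderiv_pCons poly_root_prod del: mult_pCons_left)

text \<open>With \<open>P = (X - x i) R\<close> one has \<open>P''(x i) = 2 R'(x i)\<close>, and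
  \<open>R' / R\<close> is a sum of reciprocals. This ratio turns a differential equation into
  equilibrium equations for the zeros.\<close>

lemma poly_pderiv_pderiv_root_prod:
  assumes "finite A" "i \<in> A" "inj_on x A"
  shows "poly (pderiv (pderiv (root_prod A x))) (x i) =
    2 * (\<Sum>j\<in>A - {i}. 1 / (x i - x j)) * (\<Prod>j\<in>A - {i}. x i - x j)"
proof -
  let ?B = "A - {i}"
  have "poly (pderiv (pderiv (root_prod A x))) (x i) = 2 * poly (pderiv (root_prod ?B x)) (x i)"
    unfolding root_prod_remove[OF assms(1,2)]
    by (simp add: pderiv_mult pderiv_pCons pderiv_add del: mult_pCons_left)
  also have "poly (pderiv (root_prod ?B x)) (x i) = (\<Sum>j\<in>?B. \<Prod>l\<in>?B - {j}. x i - x l)"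
    unfolding root_prod_def by (simp add: pderiv_prod poly_sum poly_prod pderiv_pCons)
  also have "\<dots> = (\<Sum>j\<in>?B. 1 / (x i - x j) * (\<Prod>l\<in>?B. x i - x l))"
  proof (rule sum.cong)
    fix j assume j: "j \<in> ?B"
    then have "x i \<noteq> x j" using assms by (auto dest: inj_onD)
    moreover have "(\<Prod>l\<in>?B. x i - x l) = (x i - x j) * (\<Prod>l\<in>?B - {j}. x i - x l)"
      using assms j by (intro prod.remove) auto
    ultimately show "(\<Prod>l\<in>?B - {j}. x i - x l) = 1 / (x i - x j) * (\<Prod>l\<in>?B. x i - x l)" by simp
  qed simp
  finally show ?thesis by (simp add: sum_distrib_right)
qed

lemma eq_root_prod:
  assumes "finite A" "inj_on x A" "degree p = card A" "\<And>i. i \<in> A \<Longrightarrow> poly p (x i) = 0"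
  shows "p = smult (lead_coeff p) (root_prod A x)"
proof (rule poly_eqI_degree_lead_coeff[where n = "card A" and A = "x ` A"])
  show "coeff p (card A) = coeff (smult (lead_coeff p) (root_prod A x)) (card A)"
    using lead_coeff_root_prod[of A x] by (simp add: assms(3) del: lead_coeff_root_prod)
  show "card A \<le> card (x ` A)" using assms by (simp add: card_image)
  show "poly p z = poly (smult (lead_coeff p) (root_prod A x)) z" if "z \<in> x ` A" for z
    using that assms by (auto simp: poly_root_prod)
qed (use assms in \<open>auto intro: order_trans[OF degree_smult_le]\<close>)

text \<open>Partial fractions: \<open>Q / P = 1 + (\<Sum>i. A\<^sub>i / (x - x\<^sub>i))\<close> with \<open>A\<^sub>i = Q(x\<^sub>i) / P'(x\<^sub>i)\<close>,
  and the Wronskian is \<open>P\<^sup>2 (Q / P)'\<close>.\<close>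

lemma wronskian_root_prod_nonzero:
  fixes x y :: "'i \<Rightarrow> real" and A :: "'i set"
  defines "P \<equiv> root_prod A x" and "Q \<equiv> root_prod A y"
  assumes A: "finite A" "A \<noteq> {}" "inj_on x A"
    and neg: "\<And>i. i \<in> A \<Longrightarrow> poly Q (x i) / poly (pderiv P) (x i) < 0"
  shows "poly (wronskian P Q) u \<noteq> 0"
proof -
  define Pi where "Pi i = root_prod (A - {i}) x" for i
  define a where "a i = poly Q (x i) / poly (pderiv P) (x i)" for i
  have P: "P = [:- x i, 1:] * Pi i" if "i \<in> A" for i
    using root_prod_remove[OF A(1) that] by (simp add: P_def Pi_def)
  have degPi: "degree (Pi i) = card A - 1" if "i \<in> A" for i
    using that A by (simp add: Pi_def)
  \<comment> \<open>Lagrange interpolation: both sides are monic of degree \<open>card A\<close> and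
    agree at the \<open>card A\<close> nodes.\<close>
  have Q: "Q = P + (\<Sum>i\<in>A. smult (a i) (Pi i))"
  proof (rule poly_eqI_degree_lead_coeff[where n = "card A" and A = "x ` A"])
    have cA: "card A \<noteq> 0" using A by simp
    have "coeff (Pi i) (card A) = 0" if "i \<in> A" for i
      using degPi[OF that] cA by (intro coeff_eq_0) simp
    then show "coeff Q (card A) = coeff (P + (\<Sum>i\<in>A. smult (a i) (Pi i))) (card A)"
      using lead_coeff_root_prod[of A x] lead_coeff_root_prod[of A y]
      by (simp add: coeff_sum P_def Q_def del: lead_coeff_root_prod)
    show "card A \<le> card (x ` A)" using A by (simp add: card_image)
    show "degree Q \<le> card A" by (simp add: Q_def)
    show "degree (P + (\<Sum>i\<in>A. smult (a i) (Pi i))) \<le> card A"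
      by (intro degree_add_le degree_sum_le A order_trans[OF degree_smult_le])
        (simp_all add: P_def degPi)
    fix z assume "z \<in> x ` A"
    then obtain k where k: "k \<in> A" "z = x k" by auto
    have dP: "poly (pderiv P) (x k) = poly (Pi k) (x k)"
      using poly_pderiv_root_prod[OF A(1) k(1)] by (simp add: P_def Pi_def poly_root_prod)
    have "(\<Sum>i\<in>A. a i * poly (Pi i) (x k)) = (\<Sum>i\<in>{k}. a i * poly (Pi i) (x k))"
      using A k by (intro sum.mono_neutral_right) (auto simp: Pi_def poly_root_prod)
    also have "\<dots> = poly Q (x k)" using neg[OF k(1)] by (auto simp: a_def dP)
    finally show "poly Q z = poly (P + (\<Sum>i\<in>A. smult (a i) (Pi i))) z"
      by (simp add: k P[OF k(1)] poly_sum)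
  qed
  have pd: "pderiv (\<Sum>i\<in>A. f i) = (\<Sum>i\<in>A. pderiv (f i))" for f :: "'i \<Rightarrow> real poly"
    using higher_pderiv_sum[of 1 f A] by simp
  have "wronskian P Q = wronskian P P + (\<Sum>i\<in>A. smult (a i) (wronskian P (Pi i)))"
    unfolding Q wronskian_def
    by (simp add: pderiv_add pd pderiv_smult distrib_left sum_distrib_left
        smult_diff_right sum_subtractf algebra_simps)
  also have "\<dots> = (\<Sum>i\<in>A. smult (a i) (- (Pi i * Pi i)))"
  proof -
    \<comment> \<open>\<open>P\<close> is \<open>Pi i\<close> times a monic linear factor, so the
      terms with the derivative of \<open>Pi i\<close> cancel.\<close>
    have "wronskian P (Pi i) = - (Pi i * Pi i)" if "i \<in> A" for i
      unfolding wronskian_def P[OF that] pderiv_mult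
      by (simp add: pderiv_pCons algebra_simps)
    then show ?thesis by (simp add: wronskian_def)
  qed
  finally have W: "poly (wronskian P Q) u = (\<Sum>i\<in>A. - a i * (poly (Pi i) u)\<^sup>2)"
    by (simp add: poly_sum power2_eq_square)
  have pos: "- a i * (poly (Pi i) u)\<^sup>2 \<ge> 0" if "i \<in> A" for i
    using neg[OF that] by (intro mult_nonneg_nonneg) (simp_all add: a_def)
  \<comment> \<open>Strict positivity needs one nonzero summand: at a node \<open>x k\<close> it is
    the one of index \<open>k\<close>, elsewhere any index will do.\<close>
  obtain k where k: "k \<in> A" "poly (Pi k) u \<noteq> 0"
  proof (cases "\<exists>k\<in>A. u = x k")
    case True
    then obtain k where k: "k \<in> A" "u = x k" by blast
    then have "poly (Pi k) u \<noteq> 0"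
      using A by (auto simp: Pi_def poly_root_prod dest: inj_onD)
    then show ?thesis using that k by blast
  next
    case False
    moreover obtain k where k: "k \<in> A" using A by blast
    ultimately have "poly (Pi k) u \<noteq> 0" using A by (auto simp: Pi_def poly_root_prod)
    then show ?thesis using that k by blast
  qed
  have "- a k * (poly (Pi k) u)\<^sup>2 > 0" using k neg[OF k(1)] by (intro mult_pos_pos) (simp_all add: a_def)
  then have "(\<Sum>i\<in>A. - a i * (poly (Pi i) u)\<^sup>2) > 0" using A pos k(1) by (intro sum_pos2) auto
  then show ?thesis using W by simp
qed

section \<open>Identities for Laguerre polynomials\<close>

text \<open>For \<beta> > -1 the Gamma quotient avoids the poles and becomes a Pochhammer symbol,
  which reduces later identities to rational arithmetic on coefficients.\<close>

lemma coeff_laguerre: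
  assumes "\<beta> > -1"
  shows "coeff (laguerre n \<beta>) k = (if k \<le> n then
    (-1) ^ k * pochhammer (\<beta> + real k + 1) (n - k) / (fact (n - k) * fact k) else 0)"
proof -
  have "(-1) ^ k * (Gamma (real n + \<beta> + 1) / (Gamma (real n - real k + 1) * Gamma (\<beta> + real k + 1))) / fact k
    = (-1) ^ k * pochhammer (\<beta> + real k + 1) (n - k) / (fact (n - k) * fact k)" if "k \<le> n"
  proof -
    have pos: "\<beta> + real k + 1 > 0" using assms by linarith
    then have nonpos: "\<beta> + real k + 1 \<notin> \<int>\<^sub>\<le>\<^sub>0" by (auto elim!: nonpos_Ints_cases)
    have G: "Gamma (real n - real k + 1) = fact (n - k)"
      using Gamma_fact[of "n - k", where 'a = real] that by (simp add: add.commute of_nat_diff)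
    have "pochhammer (\<beta> + real k + 1) (n - k) = Gamma (real n + \<beta> + 1) / Gamma (\<beta> + real k + 1)"
      using pochhammer_Gamma[OF nonpos, of "n - k"] that by (simp add: of_nat_diff algebra_simps)
    then show ?thesis by (simp add: G)
  qed
  then show ?thesis unfolding laguerre_def by (simp add: coeff_sum coeff_monom if_distrib cong: if_cong)
qed

text \<open>This two-term recursion is Laguerre's differential equation read off coefficient by
  coefficient.\<close>

lemma coeff_laguerre_Suc:
  assumes "\<beta> > -1"
  shows "(real k + 1) * (\<beta> + real k + 1) * coeff (laguerre n \<beta>) (Suc k)
    = - (real n - real k) * coeff (laguerre n \<beta>) k"
proof (cases "k < n")
  case True
  then obtain m where m: "n = Suc (k + m)" using less_iff_Suc_add by auto
  have "n - k = Suc m" "n - Suc k = m" using m by auto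
  moreover have "pochhammer (\<beta> + real k + 1) (Suc m) = (\<beta> + real k + 1) * pochhammer (\<beta> + real k + 2) m"
    by (simp add: pochhammer_rec add_ac)
  ultimately show ?thesis
    using True by (simp add: coeff_laguerre[OF assms] m divide_simps) (simp add: algebra_simps)
qed (auto simp: coeff_laguerre[OF assms])

lemma degree_laguerre:
  assumes "\<beta> > -1"
  shows "degree (laguerre n \<beta>) = n" "lead_coeff (laguerre n \<beta>) = (-1) ^ n / fact n"
proof -
  show "degree (laguerre n \<beta>) = n"
    by (rule antisym[OF degree_le le_degree]) (auto simp: coeff_laguerre[OF assms])
  then show "lead_coeff (laguerre n \<beta>) = (-1) ^ n / fact n" by (simp add: coeff_laguerre[OF assms])
qed

lemma pderiv_laguerre:
  assumes "\<beta> > -1"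
  shows "pderiv (laguerre (Suc n) \<beta>) = - laguerre n (\<beta> + 1)"
proof (rule poly_eqI)
  fix k
  have b: "\<beta> + 1 > -1" using assms by simp
  have e: "\<beta> + real (Suc k) + 1 = \<beta> + 1 + real k + 1" by simp
  show "coeff (pderiv (laguerre (Suc n) \<beta>)) k = coeff (- laguerre n (\<beta> + 1)) k"
    unfolding coeff_pderiv coeff_minus coeff_laguerre[OF assms] coeff_laguerre[OF b] e
    by (simp add: divide_simps)
qed

lemma laguerre_plus_1:
  assumes "\<beta> > -1"
  shows "laguerre n (\<beta> + 1) = laguerre n \<beta> - pderiv (laguerre n \<beta>)"
proof (rule poly_eqI)
  fix k
  have b: "\<beta> + 1 > -1" using assms by simp
  show "coeff (laguerre n (\<beta> + 1)) k = coeff (laguerre n \<beta> - pderiv (laguerre n \<beta>)) k"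
  proof (cases "k < n")
    case True
    then obtain m where m: "n = Suc (k + m)" using less_iff_Suc_add by auto
    have nk: "n - k = Suc m" "n - Suc k = m" "\<not> n \<le> k" "k \<le> n" "Suc k \<le> n" using m by auto
    \<comment> \<open>All three coefficients are reduced to the common symbol
      \<open>pochhammer (\<beta> + real k + 2) m\<close>.\<close>
    have p1: "pochhammer (\<beta> + real k + 1) (Suc m) = (\<beta> + real k + 1) * pochhammer (\<beta> + real k + 2) m"
      by (simp add: pochhammer_rec add_ac)
    have p2: "pochhammer (\<beta> + real k + 2) (Suc m) = (\<beta> + real k + 2 + real m) * pochhammer (\<beta> + real k + 2) m"
      by (simp add: pochhammer_rec' add_ac)
    have e: "\<beta> + 1 + real k + 1 = \<beta> + real k + 2" "\<beta> + real (Suc k) + 1 = \<beta> + real k + 2" by simp_all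
    show ?thesis
      unfolding coeff_diff coeff_pderiv coeff_laguerre[OF assms] coeff_laguerre[OF b] e nk p1 p2
      using nk by (simp add: divide_simps) (simp add: algebra_simps)
  qed (auto simp: coeff_pderiv coeff_laguerre[OF assms] coeff_laguerre[OF b])
qed

lemma laguerre_ode:
  assumes "\<beta> > -1"
  shows "u * poly (pderiv (pderiv (laguerre n \<beta>))) u + (\<beta> + 1 - u) * poly (pderiv (laguerre n \<beta>)) u
    + real n * poly (laguerre n \<beta>) u = 0"
proof -
  let ?L = "laguerre n \<beta>"
  have "pCons 0 (pderiv (pderiv ?L)) + smult (\<beta> + 1) (pderiv ?L) - pCons 0 (pderiv ?L) + smult (real n) ?L = 0"
  proof (rule poly_eqI)
    fix k
    show "coeff (pCons 0 (pderiv (pderiv ?L)) + smult (\<beta> + 1) (pderiv ?L) - pCons 0 (pderiv ?L)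
        + smult (real n) ?L) k = coeff 0 k"
      using coeff_laguerre_Suc[OF assms, of k n]
      by (cases k) (simp_all add: coeff_pderiv algebra_simps)
  qed
  then have "poly (pCons 0 (pderiv (pderiv ?L)) + smult (\<beta> + 1) (pderiv ?L) - pCons 0 (pderiv ?L)
        + smult (real n) ?L) u = 0" by simp
  then show ?thesis by (simp add: algebra_simps)
qed

text \<open>Raising the parameter by 1 twice gives \<open>L - 2 L' + L''\<close>; the differential
  equation then eliminates \<open>u L''\<close>.\<close>

lemma laguerre_plus_2:
  assumes "\<beta> > -1"
  shows "u * poly (laguerre n (\<beta> + 2)) u
    = (u - real n) * poly (laguerre n \<beta>) u - (u + \<beta> + 1) * poly (pderiv (laguerre n \<beta>)) u"
proof -
  let ?L = "laguerre n \<beta>"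
  have "laguerre n (\<beta> + 2) = laguerre n (\<beta> + 1) - pderiv (laguerre n (\<beta> + 1))"
    using laguerre_plus_1[of "\<beta> + 1" n] assms by (simp add: add.assoc)
  then have "laguerre n (\<beta> + 2) = ?L - pderiv ?L - pderiv (?L - pderiv ?L)"
    using laguerre_plus_1[OF assms] by simp
  then have "poly (laguerre n (\<beta> + 2)) u
      = poly ?L u - 2 * poly (pderiv ?L) u + poly (pderiv (pderiv ?L)) u"
    by (simp add: pderiv_diff)
  then show ?thesis using laguerre_ode[OF assms, of u n] by algebra
qed

text \<open>The differential equation with both derivatives expressed through
  \<open>laguerre n (\<beta> + 1)\<close>. It gives the sign of
  \<open>laguerre (Suc n) \<beta>\<close> at its positive critical points.\<close>

lemma laguerre_Suc:
  assumes "\<beta> > -1"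
  shows "real (Suc n) * poly (laguerre (Suc n) \<beta>) u
    = (\<beta> + 1 - u) * poly (laguerre n (\<beta> + 1)) u + u * poly (pderiv (laguerre n (\<beta> + 1))) u"
  using laguerre_ode[OF assms, of u "Suc n"]
  unfolding pderiv_laguerre[OF assms] pderiv_minus by (simp add: algebra_simps)

section \<open>Zeros of Laguerre polynomials\<close>

lemma root_between_sign_change:
  fixes p :: "real poly"
  assumes "u < v" "0 < (-1) ^ i * poly p u" "0 < (-1) ^ Suc i * poly p v"
  shows "\<exists>z. u < z \<and> z < v \<and> poly p z = 0"
  using assms poly_IVT_neg[of u v p] poly_IVT_pos[of u v p] by (cases "even i") auto

text \<open>Exactly the \<open>n - 1 - i\<close> factors with \<open>j > i\<close> are
  negative.\<close>

lemma prod_diff_sign: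
  fixes x :: "nat \<Rightarrow> real"
  assumes "strict_mono_on {..<n} x" "i < n"
  shows "0 < (-1) ^ (n - 1 - i) * (\<Prod>j\<in>{..<n} - {i}. x i - x j)"
proof -
  have S: "{..<n} - {i} = {..<i} \<union> {Suc i..<n}" using assms(2) by auto
  have "(\<Prod>j\<in>{..<n} - {i}. x i - x j) = (\<Prod>j<i. x i - x j) * (\<Prod>j\<in>{Suc i..<n}. x i - x j)"
    unfolding S by (rule prod.union_disjoint) auto
  then have "(-1) ^ (n - 1 - i) * (\<Prod>j\<in>{..<n} - {i}. x i - x j)
      = (\<Prod>j<i. x i - x j) * (\<Prod>j\<in>{Suc i..<n}. (-1) * (x i - x j))"
    unfolding prod.distrib by simp
  moreover have "0 < (\<Prod>j<i. x i - x j)"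
    using assms strict_mono_onD[OF assms(1)] by (intro prod_pos) auto
  moreover have "0 < (\<Prod>j\<in>{Suc i..<n}. (-1) * (x i - x j))"
    using assms strict_mono_onD[OF assms(1)] by (intro prod_pos) auto
  ultimately show ?thesis by simp
qed

text \<open>The factorisation makes \<open>x\<close> list every zero exactly once, counted from
  index 0; the values from index \<open>n\<close> on are arbitrary.\<close>

definition laguerre_zeros :: "nat \<Rightarrow> real \<Rightarrow> (nat \<Rightarrow> real) \<Rightarrow> bool" where
  "laguerre_zeros n \<beta> x \<longleftrightarrow> strict_mono_on {..<n} x \<and> (\<forall>i<n. 0 < x i) \<and>
     laguerre n \<beta> = smult ((-1) ^ n / fact n) (root_prod {..<n} x)"

lemma
  assumes "laguerre_zeros n \<beta> x"
  shows laguerre_zeros_less: "i < j \<Longrightarrow> j < n \<Longrightarrow> x i < x j"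
    and laguerre_zeros_inj: "inj_on x {..<n}"
    and laguerre_zeros_pos: "i < n \<Longrightarrow> 0 < x i"
    and laguerre_zeros_eq: "laguerre n \<beta> = smult ((-1) ^ n / fact n) (root_prod {..<n} x)"
    and laguerre_zeros_root: "i < n \<Longrightarrow> poly (laguerre n \<beta>) (x i) = 0"
    and laguerre_zeros_pderiv: "i < n \<Longrightarrow> 0 < (-1) ^ Suc i * poly (pderiv (laguerre n \<beta>)) (x i)"
proof -
  have m: "strict_mono_on {..<n} x" and p: "\<forall>i<n. 0 < x i"
    and e: "laguerre n \<beta> = smult ((-1) ^ n / fact n) (root_prod {..<n} x)"
    using assms by (auto simp: laguerre_zeros_def)
  show "i < j \<Longrightarrow> j < n \<Longrightarrow> x i < x j" using strict_mono_onD[OF m] by auto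
  show "inj_on x {..<n}" using m by (rule strict_mono_on_imp_inj_on)
  show "i < n \<Longrightarrow> 0 < x i" using p by blast
  show "laguerre n \<beta> = smult ((-1) ^ n / fact n) (root_prod {..<n} x)" by (rule e)
  show "i < n \<Longrightarrow> poly (laguerre n \<beta>) (x i) = 0" by (auto simp: e poly_root_prod)
  assume i: "i < n"
  then obtain m' where m': "n = Suc (i + m')" using less_iff_Suc_add by auto
  \<comment> \<open>The sign of the leading coefficient absorbs \<open>n\<close>, so the sign of the
    derivative depends on \<open>i\<close> alone.\<close>
  have "(-1) ^ Suc i * (-1) ^ n = ((-1) ^ (n - 1 - i) :: real)"
    by (simp add: m' power_add flip: power_mult_distrib)
  then have "(-1) ^ Suc i * poly (pderiv (laguerre n \<beta>)) (x i)
      = (-1) ^ (n - 1 - i) * (\<Prod>j\<in>{..<n} - {i}. x i - x j) / fact n"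
    using poly_pderiv_root_prod[of "{..<n}" i x] i
    by (simp add: e pderiv_smult flip: mult.assoc)
  then show "0 < (-1) ^ Suc i * poly (pderiv (laguerre n \<beta>)) (x i)"
    using prod_diff_sign[OF m i] by simp
qed

text \<open>Induction on \<open>n\<close> with growing parameter: the \<open>n\<close> zeros of
  \<open>laguerre n (\<beta> + 1)\<close> are critical points of
  \<open>laguerre (Suc n) \<beta>\<close>. Together with 0 and a large \<open>b\<close> they give
  \<open>n + 2\<close> points of alternating sign.\<close>

lemma laguerre_zeros_exist:
  assumes "\<beta> > -1"
  shows "\<exists>x. laguerre_zeros n \<beta> x"
  using assms
proof (induction n arbitrary: \<beta>)
  case 0
  have "laguerre 0 \<beta> = 1"
    by (rule poly_eqI) (auto simp: coeff_laguerre[OF 0] )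
  then show ?case by (simp add: laguerre_zeros_def root_prod_def)
next
  case (Suc n)
  let ?L = "laguerre (Suc n) \<beta>" and ?M = "laguerre n (\<beta> + 1)"
  obtain z where z: "laguerre_zeros n (\<beta> + 1) z" using Suc by fastforce
  \<comment> \<open>Beyond all \<open>z i\<close> and far enough out, the leading coefficient
    decides the sign. Inserting 0 makes \<open>b\<close> positive and covers
    \<open>n = 0\<close>.\<close>
  obtain b where b: "\<And>i. i < n \<Longrightarrow> z i < b" "0 < b" "0 < (-1) ^ Suc n * poly ?L b"
  proof -
    have "lead_coeff (smult ((-1) ^ Suc n) ?L) > 0"
      unfolding lead_coeff_smult degree_laguerre(2)[OF Suc.prems] by (simp flip: power_mult_distrib)
    then obtain N where N: "\<And>u. u \<ge> N \<Longrightarrow> poly (smult ((-1) ^ Suc n) ?L) u > 0"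
      using poly_pinfty_gt_lc[of "smult ((-1) ^ Suc n) ?L"] by force
    define b where "b = max N (Max (insert 0 (z ` {..<n})) + 1)"
    have "v < b" if "v \<in> insert 0 (z ` {..<n})" for v
      using Max_ge[OF _ that] by (simp add: b_def less_max_iff_disj)
    then show ?thesis using N[of b] that[of b] by (auto simp: b_def)
  qed
  \<comment> \<open>The test points in increasing order; \<open>z\<close> is shifted by one to make
    room for 0.\<close>
  define e where "e i = (if i = 0 then 0 else if i \<le> n then z (i - 1) else b)" for i
  have e_less: "e i < e (Suc i)" if "i \<le> n" for i
    using that b laguerre_zeros_pos[OF z] laguerre_zeros_less[OF z] by (auto simp: e_def)
  have e_mono: "e i \<le> e j" if "i \<le> j" "j \<le> Suc n" for i j
    using that
  proof (induction rule: dec_induct)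
    case (step m)
    then show ?case using e_less[of m] by simp
  qed simp
  have sign: "0 < (-1) ^ i * poly ?L (e i)" if i: "i \<le> Suc n" for i
  proof -
    consider "i = 0" | j where "i = Suc j" "j < n" | "i = Suc n"
      using i by (cases i) (auto simp: le_less)
    then show ?thesis
    proof cases
      case 1
      have "coeff ?L 0 > 0"
        using Suc.prems by (simp add: coeff_laguerre pochhammer_pos)
      then show ?thesis using 1 by (simp add: e_def poly_0_coeff_0)
    next
      case 2
      have "real (Suc n) * ((-1) ^ i * poly ?L (z j)) = (-1) ^ i * (real (Suc n) * poly ?L (z j))"
        by simp
      also have "\<dots> = z j * ((-1) ^ Suc j * poly (pderiv ?M) (z j))"
        unfolding laguerre_Suc[OF Suc.prems] laguerre_zeros_root[OF z 2(2)] 2(1) by simp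
      also have "\<dots> > 0"
        using 2(2) by (intro mult_pos_pos laguerre_zeros_pos[OF z] laguerre_zeros_pderiv[OF z])
      finally have "0 < (-1) ^ i * poly ?L (z j)" by (subst (asm) zero_less_mult_iff) linarith
      then show ?thesis using 2 by (simp add: e_def)
    next
      case 3
      then show ?thesis using b by (simp add: e_def)
    qed
  qed
  have "\<exists>u. e i < u \<and> u < e (Suc i) \<and> poly ?L u = 0" if "i < Suc n" for i
    using e_less[of i] sign[of i] sign[of "Suc i"] that
    by (intro root_between_sign_change[of _ _ i]) auto
  then obtain x where x: "\<And>i. i < Suc n \<Longrightarrow> e i < x i \<and> x i < e (Suc i) \<and> poly ?L (x i) = 0"
    by metis
  have mono: "strict_mono_on {..<Suc n} x"
  proof (rule strict_mono_onI)
    fix i j assume "i \<in> {..<Suc n}" "j \<in> {..<Suc n}" "i < j"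
    then show "x i < x j" using x[of i] x[of j] e_mono[of "Suc i" j] by fastforce
  qed
  have "0 < x i" if "i < Suc n" for i
    using x[OF that] e_mono[of 0 i] that by (simp add: e_def[of 0])
  moreover have "?L = smult ((-1) ^ Suc n / fact (Suc n)) (root_prod {..<Suc n} x)"
    using eq_root_prod[of "{..<Suc n}" x ?L] strict_mono_on_imp_inj_on[OF mono] x
      degree_laguerre[OF Suc.prems, of "Suc n"] by auto
  ultimately show ?case using mono unfolding laguerre_zeros_def by blast
qed

section \<open>Stieltjes' equations and comparison of zeros for different parameters\<close>

text \<open>Divide the differential equation at the zero \<open>x k\<close> by \<open>x k\<close>
  times the first derivative there; the ratio of second to first derivative is the sum over the
  other zeros.\<close>

lemma stieltjes_relation:
  assumes "\<beta> > -1" and x: "laguerre_zeros n \<beta> x" and k: "k < n"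
  shows "(\<Sum>j\<in>{..<n} - {k}. 2 / (x k - x j)) + (\<beta> + 1) / x k = 1"
proof -
  define S where "S = (\<Sum>j\<in>{..<n} - {k}. 1 / (x k - x j))"
  let ?D = "poly (pderiv (laguerre n \<beta>)) (x k)"
  have "poly (pderiv (pderiv (laguerre n \<beta>))) (x k) = 2 * S * ?D"
    using poly_pderiv_pderiv_root_prod[of "{..<n}" k x] poly_pderiv_root_prod[of "{..<n}" k x]
      laguerre_zeros_inj[OF x] k
    by (simp add: laguerre_zeros_eq[OF x] pderiv_smult S_def)
  then have "(x k * 2 * S + (\<beta> + 1 - x k)) * ?D = 0"
    using laguerre_ode[OF assms(1), of "x k" n] laguerre_zeros_root[OF x k] by (simp add: algebra_simps)
  moreover have "?D \<noteq> 0" using laguerre_zeros_pderiv[OF x k] by auto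
  ultimately have "x k * 2 * S + (\<beta> + 1 - x k) = 0" by simp
  then have "2 * S + (\<beta> + 1) / x k = 1" using laguerre_zeros_pos[OF x k] by (simp add: field_simps)
  then show ?thesis by (simp add: S_def sum_distrib_left)
qed

text \<open>Dilate the larger configuration \<open>y\<close> until it dominates \<open>x\<close> and touches it at an index \<open>k\<close>:
  there all interactions, and hence the Stieltjes sums, are comparable.\<close>

lemma laguerre_zeros_increasing:
  assumes \<alpha>: "\<alpha> > -1" and \<beta>: "\<alpha> < \<beta>"
    and x: "laguerre_zeros n \<alpha> x" and y: "laguerre_zeros n \<beta> y" and i: "i < n"
  shows "x i < y i"
proof (rule ccontr)
  assume neg: "\<not> x i < y i"
  let ?R = "(\<lambda>j. x j / y j) ` {..<n}"
  \<comment> \<open>The least dilation factor for which \<open>c * y j\<close> dominates every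
    \<open>x j\<close>; contact occurs at the index attaining the maximum.\<close>
  define c where "c = Max ?R"
  have fin: "finite ?R" "?R \<noteq> {}" using i by auto
  obtain k where k: "k < n" "c = x k / y k" using Max_in[OF fin] by (auto simp: c_def)
  have ypos: "0 < y j" if "j < n" for j using laguerre_zeros_pos[OF y that] .
  have le: "x j \<le> c * y j" if "j < n" for j
  proof -
    have "x j / y j \<le> c" unfolding c_def using that by (intro Max_ge fin) auto
    then show ?thesis using ypos[OF that] by (simp add: field_simps)
  qed
  have "x i / y i \<le> c" unfolding c_def using i by (intro Max_ge fin) auto
  moreover have "1 \<le> x i / y i" using neg ypos[OF i] by simp
  ultimately have c: "c \<ge> 1" by linarith
  have xk: "x k = c * y k" using k ypos[of k] by simp
  have "(\<Sum>j\<in>{..<n} - {k}. 2 / (x k - x j)) \<le> (\<Sum>j\<in>{..<n} - {k}. 2 / (y k - y j) / c)"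
  proof (rule sum_mono)
    fix j assume j: "j \<in> {..<n} - {k}"
    have *: "c * (y k - y j) \<le> x k - x j" using le[of j] j by (simp add: xk algebra_simps)
    \<comment> \<open>Both differences are positive for \<open>j < k\<close> and negative for
      \<open>j > k\<close>, so taking reciprocals reverses the inequality in either case.\<close>
    have "1 / (x k - x j) \<le> 1 / (c * (y k - y j))"
    proof (cases "j < k")
      case True
      then have "0 < c * (y k - y j)" using c laguerre_zeros_less[OF y, of j k] k(1) by (intro mult_pos_pos) auto
      then show ?thesis using * by (intro divide_left_mono) auto
    next
      case False
      then have "x k - x j < 0" using laguerre_zeros_less[OF x, of k j] j by simp
      then show ?thesis using * by (intro divide_left_mono) (auto simp: mult_neg_neg)
    qed
    then have "2 * (1 / (x k - x j)) \<le> 2 * (1 / (c * (y k - y j)))" by simp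
    then show "2 / (x k - x j) \<le> 2 / (y k - y j) / c" by (simp add: mult.commute)
  qed
  also have "\<dots> = (1 - (\<beta> + 1) / y k) / c"
    unfolding sum_divide_distrib[symmetric]
    using stieltjes_relation[OF _ y k(1)] \<alpha> \<beta> by (simp add: eq_diff_eq)
  finally have "1 - (\<alpha> + 1) / x k \<le> (1 - (\<beta> + 1) / y k) / c"
    using stieltjes_relation[OF \<alpha> x k(1)] by linarith
  \<comment> \<open>Contact gives the two parameter terms the common denominator \<open>x k\<close>.
    Since \<alpha> < \<beta>, this yields \<open>1 < 1 / c\<close>, against
    \<open>c \<ge> 1\<close>.\<close>
  also have "\<dots> = 1 / c - (\<beta> + 1) / x k" using c by (simp add: xk diff_divide_distrib mult.commute)
  also have "\<dots> < 1 / c - (\<alpha> + 1) / x k"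
    using \<beta> laguerre_zeros_pos[OF x k(1)] by (simp add: divide_strict_right_mono)
  finally show False using c by simp
qed

text \<open>\<open>laguerre_plus_2\<close> makes the signs of the polynomial with parameter \<alpha>
  + 2 alternate along the \<open>x j\<close>. Hence at least \<open>i + 1\<close> of its zeros lie
  below \<open>x (Suc i)\<close>.\<close>

lemma laguerre_zeros_plus_2:
  assumes \<alpha>: "\<alpha> > -1" and x: "laguerre_zeros n \<alpha> x" and w: "laguerre_zeros n (\<alpha> + 2) w"
    and i: "Suc i < n"
  shows "w i < x (Suc i)"
proof (rule ccontr)
  assume neg: "\<not> w i < x (Suc i)"
  let ?Q = "laguerre n (\<alpha> + 2)"
  have sign: "0 < (-1) ^ j * poly ?Q (x j)" if j: "j < n" for j
  proof -
    have "x j * ((-1) ^ j * poly ?Q (x j)) = (-1) ^ j * (x j * poly ?Q (x j))" by simp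
    also have "\<dots> = (x j + \<alpha> + 1) * ((-1) ^ Suc j * poly (pderiv (laguerre n \<alpha>)) (x j))"
      unfolding laguerre_plus_2[OF \<alpha>] laguerre_zeros_root[OF x j] by simp
    also have "\<dots> > 0"
      by (rule mult_pos_pos[OF _ laguerre_zeros_pderiv[OF x j]])
        (use laguerre_zeros_pos[OF x j] \<alpha> in linarith)
    finally show ?thesis using laguerre_zeros_pos[OF x j] by (simp add: zero_less_mult_iff)
  qed
  have "\<exists>u. x j < u \<and> u < x (Suc j) \<and> poly ?Q u = 0" if "Suc j < n" for j
    using laguerre_zeros_less[OF x, of j "Suc j"] sign[of j] sign[of "Suc j"] that
    by (intro root_between_sign_change[of _ _ j]) auto
  then obtain v where v: "\<And>j. Suc j < n \<Longrightarrow> x j < v j \<and> v j < x (Suc j) \<and> poly ?Q (v j) = 0"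
    by metis
  have xle: "x j \<le> x l" if "j \<le> l" "l < n" for j l
    using laguerre_zeros_less[OF x, of j l] that by (cases "j = l") auto
  have inj: "inj_on v {..i}"
  proof (rule linorder_inj_onI)
    fix j l assume "j < l" "j \<in> {..i}" "l \<in> {..i}"
    then show "v j \<noteq> v l" using v[of j] v[of l] xle[of "Suc j" l] i by auto
  qed auto
  \<comment> \<open>If \<open>w i\<close> were not below \<open>x (Suc i)\<close>, the
    \<open>i + 1\<close> distinct zeros \<open>v j\<close> would have to fit among the first
    \<open>i\<close> values of \<open>w\<close>.\<close>
  have "v ` {..i} \<subseteq> w ` {..<i}"
  proof
    fix u assume "u \<in> v ` {..i}"
    then obtain j where j: "j \<le> i" "u = v j" by auto
    have u: "poly ?Q u = 0" "u < x (Suc i)"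
      using v[of j] j i xle[of "Suc j" "Suc i"] by auto
    then obtain l where l: "l < n" "u = w l"
      by (auto simp: laguerre_zeros_eq[OF w] poly_root_prod)
    have "l < i"
    proof (rule ccontr)
      assume "\<not> l < i"
      then have "w i \<le> w l" using laguerre_zeros_less[OF w, of i l] l(1) by (cases "l = i") auto
      then show False using neg u l by simp
    qed
    then show "u \<in> w ` {..<i}" using l by simp
  qed
  then have "card (v ` {..i}) \<le> card (w ` {..<i})" by (intro card_mono) auto
  also have "\<dots> \<le> i" using card_image_le[of "{..<i}" w] by simp
  finally show False using inj by (simp add: card_image)
qed

text \<open>The lower bound is monotonicity from \<alpha> to \<alpha> + t. For the upper bound,
  monotonicity from \<alpha> + t to \<alpha> + 2 reduces t < 2 to the case t = 2.\<close>

lemma laguerre_zeros_interlace: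
  assumes \<alpha>: "\<alpha> > -1" and t: "0 < t" "t \<le> 2"
    and x: "laguerre_zeros n \<alpha> x" and y: "laguerre_zeros n (\<alpha> + t) y" and i: "i < n"
  shows "x i < y i" "Suc i < n \<Longrightarrow> y i < x (Suc i)"
proof -
  show "x i < y i" using laguerre_zeros_increasing[OF \<alpha> _ x y i] t by simp
  assume si: "Suc i < n"
  obtain w where w: "laguerre_zeros n (\<alpha> + 2) w" using laguerre_zeros_exist[of "\<alpha> + 2" n] \<alpha> by auto
  show "y i < x (Suc i)"
  proof (cases "t = 2")
    case True
    then show ?thesis using laguerre_zeros_plus_2[OF \<alpha> x _ si] y by simp
  next
    case False
    then have "y i < w i" using laguerre_zeros_increasing[OF _ _ y w i] \<alpha> t by simp
    then show ?thesis using laguerre_zeros_plus_2[OF \<alpha> x w si] by simp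
  qed
qed

lemma wronskian_laguerre_nonzero:
  assumes \<alpha>: "\<alpha> > -1" and t: "0 < t" "t \<le> 2" and n: "n \<ge> 1"
  shows "poly (wronskian (laguerre n \<alpha>) (laguerre n (\<alpha> + t))) u \<noteq> 0"
proof -
  obtain x where x: "laguerre_zeros n \<alpha> x" using laguerre_zeros_exist[OF \<alpha>] by blast
  obtain y where y: "laguerre_zeros n (\<alpha> + t) y"
    using laguerre_zeros_exist[of "\<alpha> + t" n] \<alpha> t by auto
  note il = laguerre_zeros_interlace[OF \<alpha> t x y]
  let ?P = "root_prod {..<n} x" and ?Q = "root_prod {..<n} y"
  have "poly ?Q (x i) / poly (pderiv ?P) (x i) < 0" if "i \<in> {..<n}" for i
  proof -
    have i: "i < n" using that by simp
    \<comment> \<open>The factor of index \<open>i\<close> is negative; for every other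
      \<open>j\<close> interlacing puts \<open>x j\<close> and \<open>y j\<close> on the same side
      of \<open>x i\<close>, so the quotient is positive.\<close>
    have "poly ?Q (x i) / poly (pderiv ?P) (x i)
      = (x i - y i) * (\<Prod>j\<in>{..<n} - {i}. (x i - y j) / (x i - x j))"
      using i by (simp add: poly_root_prod poly_pderiv_root_prod prod_dividef
        prod.remove[of "{..<n}" i "\<lambda>j. x i - y j"])
    moreover have "0 < (\<Prod>j\<in>{..<n} - {i}. (x i - y j) / (x i - x j))"
    proof (rule prod_pos)
      fix j assume j: "j \<in> {..<n} - {i}"
      show "0 < (x i - y j) / (x i - x j)"
      proof (cases "j < i")
        case True
        then have "x (Suc j) \<le> x i"
          using laguerre_zeros_less[OF x, of "Suc j" i] i by (cases "Suc j = i") auto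
        then have "y j < x i" using il(2)[of j] True i by simp
        then show ?thesis using laguerre_zeros_less[OF x True i] by simp
      next
        case False
        then have "x i < x j" "x j < y j"
          using laguerre_zeros_less[OF x, of i j] il(1)[of j] j by auto
        then show ?thesis by (intro divide_neg_neg) auto
      qed
    qed
    ultimately show ?thesis using il(1)[OF i] by (simp add: mult_neg_pos)
  qed
  then have "poly (wronskian ?P ?Q) u \<noteq> 0"
    using n by (intro wronskian_root_prod_nonzero laguerre_zeros_inj[OF x]) (auto simp: lessThan_empty_iff)
  moreover have "wronskian (laguerre n \<alpha>) (laguerre n (\<alpha> + t))
    = smult (((-1) ^ n / fact n) * ((-1) ^ n / fact n)) (wronskian ?P ?Q)"
    by (simp add: laguerre_zeros_eq[OF x] laguerre_zeros_eq[OF y] wronskian_def pderiv_smult smult_diff_right mult_ac)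
  ultimately show ?thesis by simp
qed

theorem theorem2p1:
  fixes n :: nat and \<alpha> a t :: real
  assumes "n \<ge> 1" and "\<alpha> > -1" and "a \<noteq> 0" and "0 < t" and "t \<le> 2"
  shows "zeros_interlace (laguerre_comb n \<alpha> t a) (laguerre n \<alpha>) \<and>
         zeros_interlace (laguerre_comb n \<alpha> t a) (laguerre n (\<alpha> + t))"
proof -
  define p q r where "p = laguerre n \<alpha>" and "q = laguerre n (\<alpha> + t)" and "r = p + smult a q"
  obtain x where x: "laguerre_zeros n \<alpha> x" using laguerre_zeros_exist assms(2) by blast
  obtain y where y: "laguerre_zeros n (\<alpha> + t) y"
    using laguerre_zeros_exist[of "\<alpha> + t" n] assms by auto
  have W: "poly (wronskian p q) u \<noteq> 0" for u
    unfolding p_def q_def by (rule wronskian_laguerre_nonzero) (use assms in auto)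
  \<comment> \<open>The Wronskian is bilinear and alternating, so only the mixed term
    survives.\<close>
  have "wronskian r p = smult (- a) (wronskian p q)" "wronskian r q = wronskian p q"
    by (simp_all add: r_def wronskian_def pderiv_add pderiv_smult algebra_simps smult_diff_right)
  then have Wr: "poly (wronskian r p) u \<noteq> 0" "poly (wronskian r q) u \<noteq> 0"
    "poly (wronskian p r) u \<noteq> 0" for u
    using W[of u] \<open>a \<noteq> 0\<close> by (simp_all add: wronskian_commute[of p r])
  have deg: "degree p = n" "degree q = n" "degree r \<le> n"
    using assms unfolding r_def p_def q_def
    by (auto simp: degree_laguerre intro!: degree_add_le order_trans[OF degree_smult_le])
  \<comment> \<open>Each of the \<open>n - 1\<close> gaps between zeros of \<open>p\<close> supplies
    a real zero of \<open>r\<close>, enough to make all zeros of \<open>r\<close> real.\<close>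
  have "\<exists>u. x i < u \<and> u < x (Suc i) \<and> poly r u = 0" if i: "i < n - 1" for i
  proof -
    have "x i < x (Suc i)" using laguerre_zeros_less[OF x] i by simp
    moreover have "poly p z \<noteq> 0" if z: "x i < z" "z < x (Suc i)" for z
    proof
      assume "poly p z = 0"
      then obtain j where j: "j < n" "z = x j"
        by (auto simp: p_def laguerre_zeros_eq[OF x] poly_root_prod)
      have "i < n" using i by simp
      then show False
        using z j laguerre_zeros_less[OF x, of j i] laguerre_zeros_less[OF x, of "Suc i" j]
        by (cases "j = i"; cases "j = Suc i"; cases "j < i") auto
    qed
    ultimately have "consecutive_zeros p (x i) (x (Suc i))"
      using laguerre_zeros_root[OF x] i by (simp add: consecutive_zeros_def p_def)
    then show ?thesis by (intro wronskian_zero_between[OF Wr(3)])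
  qed
  then obtain v where v: "\<And>i. i < n - 1 \<Longrightarrow> x i < v i \<and> v i < x (Suc i) \<and> poly r (v i) = 0"
    by metis
  have "inj_on v {..<n - 1}"
  proof (rule linorder_inj_onI)
    fix i j assume "i < j" "i \<in> {..<n - 1}" "j \<in> {..<n - 1}"
    then show "v i \<noteq> v j"
      using v[of i] v[of j] laguerre_zeros_less[OF x, of "Suc i" j] by (cases "Suc i = j") force+
  qed auto
  then have cardV: "card (v ` {..<n - 1}) = n - 1" by (simp add: card_image)
  have cardX: "card (x ` {..<n}) = n" "card (y ` {..<n}) = n"
    using laguerre_zeros_inj[OF x] laguerre_zeros_inj[OF y] by (simp_all add: card_image)
  \<comment> \<open>The leading terms cancel when \<open>a = -1\<close>; the zeros already found
    show that the degree drops by at most one.\<close>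
  have "degree r \<ge> n - 1"
  proof -
    have "r \<noteq> 0" using Wr(1)[of 0] by (auto simp: wronskian_def)
    have "card (v ` {..<n - 1}) \<le> card {u. poly r u = 0}"
      using v by (intro card_mono poly_roots_finite[OF \<open>r \<noteq> 0\<close>]) auto
    then show ?thesis using card_poly_roots_bound[OF \<open>r \<noteq> 0\<close>] cardV by linarith
  qed
  then have "zeros_interlace r s" if "degree s = n" "\<And>u. poly (wronskian r s) u \<noteq> 0"
    "\<And>i. i < n \<Longrightarrow> poly s (z i) = 0" "card (z ` {..<n}) = n" for s and z :: "nat \<Rightarrow> real"
    using that v deg cardV
    by (intro wronskian_imp_zeros_interlace[where X = "v ` {..<n - 1}" and Y = "z ` {..<n}"]) auto
  from this[OF deg(1) Wr(1) _ cardX(1)] this[OF deg(2) Wr(2) _ cardX(2)]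
  have "zeros_interlace r p" "zeros_interlace r q"
    using laguerre_zeros_root[OF x] laguerre_zeros_root[OF y] by (simp_all add: p_def q_def)
  then show ?thesis by (simp add: laguerre_comb_def r_def p_def q_def)
qed

end
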